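(* Let $F:\hat K\to K$ be an affine diffeomorphism between nondegenerate triangles in $\mathbb{R}^2$ with $F(\hat{\mathbf x}_i)=\mathbf x_i$ for $i=1,2,3$ and constant Jacobian matrix $J$. Let $\mathcal{F}^{\mathrm{div},\mathrm{div}}$ be the double contravariant Piola map, $N$ and $\hat N$ the (ordered, 15-component) vectors of degrees of freedom of the nonconforming Arnold--Winther element on $K$ and $\hat K$, and let $\mathcal{F}_*(N)$ be the componentwise push-forward, $\mathcal{F}_*(\ell)=\ell\circ\mathcal{F}^{\mathrm{div},\mathrm{div}}$. Then, as functionals on $\mathrm{AW}^{\mathrm{nc}}(\hat K)$, $$\mathcal{F}_*(N)=\begin{bmatrix}W^1&&&\\&W^2&&\\&&W^3&\\&&&\check W\end{bmatrix}\hat N,$$ where, for $k=1,2,3$, $$W^k=\frac{\|\hat{\mathbf e}_k\|}{\|\mathbf e_k\|}\begin{bmatrix}1&0&0&0\\ \alpha^k&\beta^k&0&0\\0&0&1&0\\0&0&\alpha^k&\beta^k\end{bmatrix},\qquad \check W=\frac{1}{\det J}\begin{bmatrix}J_{11}^2&2J_{11}J_{12}&J_{12}^2\\ J_{11}J_{21}&J_{11}J_{22}+J_{12}J_{21}&J_{12}J_{22}\\ J_{21}^2&2J_{21}J_{22}&J_{22}^2\end{bmatrix}.$$ Consequently, letting $P$ be the (blockwise) inverse of this block-diagonal matrix, $\hat N=P\,\mathcal{F}_*(N)$, and the nodal basis $\mathbf\Psi$ of $\mathrm{AW}^{\mathrm{nc}}(K)$ (dual to $N$) is obtained from the nodal basis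 $\hat{\mathbf\Psi}$ of $\mathrm{AW}^{\mathrm{nc}}(\hat K)$ (dual to $\hat N$) by $\mathbf\Psi=P^T\mathcal{F}^{\mathrm{div},\mathrm{div}}(\hat{\mathbf\Psi})$, with $\mathcal{F}^{\mathrm{div},\mathrm{div}}$ applied componentwise to the vector of basis functions.
   Context: Geometry: the triangle $K$ has vertices $\mathbf x_1,\mathbf x_2,\mathbf x_3$; edge $\mathbf e_k$ is the edge not containing vertex $k$, regarded as the column vector running from its lower-numbered vertex to its higher-numbered vertex (and also as a set). Its unit tangent is $\mathbf t=\mathbf t_k=\mathbf e_k/\|\mathbf e_k\|$ and its unit normal is $\mathbf n=\mathbf n_k=R\mathbf t_k$ with $R=\begin{bmatrix}0&1\\-1&0\end{bmatrix}$. Hatted quantities are defined in the same way on $\hat K$. $F$ is allowed to reverse orientation. Piola map: with $\mathbb S=\mathbb{R}^{2\times2}_{\mathrm{sym}}$, for $\hat\tau:\hat K\to\mathbb S$, $\mathcal{F}^{\mathrm{div},\mathrm{div}}(\hat\tau)=\frac{1}{(\det J)^2}J(\hat\tau\circ F^{-1})J^T$. Edge coefficients: for each $k$, $\begin{bmatrix}\alpha^k\\ \beta^k\end{bmatrix}=\frac{1}{\det J}\begin{bmatrix}\hat{\mathbf n}_k&\hat{\mathbf t}_k\end{bmatrix}^T J^TJ\,\hat{\mathbf t}_k$. Space: $\mathrm{AW}^{\mathrm{nc}}(K)=\{\tau\in\mathcal P_2(K;\mathbb S): \mathbf n_k\cdot\tau\mathbf n_k\in\mathcal P_1(\mathbf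 e_k),\ 1\le k\le3\}$, of dimension 15, where $\mathcal P_m$ denotes polynomials of degree at most $m$. Degrees of freedom: let $\mu_0=1$ and $\mu_1$ be a basis of the polynomials of degree at most 1 on the unit interval, transferred to each edge by pullback via the affine parametrization of the edge from its lower- to its higher-numbered vertex. Set $\ell^{\mathbf n,\mathbf s,i,k}(\tau)=\int_{\mathbf e_k}(\mathbf n\cdot\tau\mathbf s)\,\mu_i\,ds$ for $\mathbf s\in\{\mathbf n,\mathbf t\}$, $i\in\{0,1\}$, and $\ell^{0,i,j}(\tau)=\int_K\tau_{ij}\,dx$. The vector of degrees of freedom is the block column vector $N=[N^1,N^2,N^3,N^4]^T$ with $N^k=[\ell^{\mathbf n,\mathbf n,0,k},\ \ell^{\mathbf n,\mathbf t,0,k},\ \ell^{\mathbf n,\mathbf n,1,k},\ \ell^{\mathbf n,\mathbf t,1,k}]^T$ for $k=1,2,3$ and $N^4=[\ell^{0,1,1},\ \ell^{0,1,2},\ \ell^{0,2,2}]^T$; these functionals are unisolvent on $\mathrm{AW}^{\mathrm{nc}}(K)$. $\hat N$ is defined identically on $\hat K$. The nodal basis $\mathbf\Psi=(\Psi_j)$ is the basis with $\ell_i(\Psi_j)=\delta_{ij}$ for the entries $\ell_i$ of $N$, and similarly for $\hat{\mathbf\Psi}$.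
   Formalization: The interior block is taken with factor 1/|det J| in place of the printed 1/det J; the two agree when det J > 0, and the printed formula fails for orientation-reversing F, e.g. J = diag(-1,1) with the constant identity tensor. *)

theory Defs
  imports "HOL-Analysis.Analysis" "HOL-Computational_Algebra.Polynomial"
begin

section \<open>Triangles\<close>

text \<open>
  A triangle is given by its numbered vertices \<open>x 1, x 2, x 3\<close>, indexed by the numeral type 3
  (in which \<open>3 = 0\<close>; the order of the vertices is therefore spelled out in \<open>lo\<close> and \<open>hi\<close>, the
  lower- and higher-numbered endpoint of the edge opposite vertex \<open>k\<close>).
\<close>

definition tri :: "(3 \<Rightarrow> real^2) \<Rightarrow> (real^2) set" where
  "tri x = convex hull (range x)"

definition nondegenerate :: "(3 \<Rightarrow> real^2) \<Rightarrow> bool" where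
  "nondegenerate x \<longleftrightarrow> \<not> collinear (range x)"

definition lo :: "3 \<Rightarrow> 3" where
  "lo k = (if k = 1 then 2 else 1)"

definition hi :: "3 \<Rightarrow> 3" where
  "hi k = (if k = 3 then 2 else 3)"

definition edge_vec :: "(3 \<Rightarrow> real^2) \<Rightarrow> 3 \<Rightarrow> real^2" where
  "edge_vec x k = x (hi k) - x (lo k)"

definition edge :: "(3 \<Rightarrow> real^2) \<Rightarrow> 3 \<Rightarrow> (real^2) set" where
  "edge x k = closed_segment (x (lo k)) (x (hi k))"

definition rot :: "real^2^2" where
  "rot = vector [vector [0, 1], vector [-1, 0]]"

definition tangent :: "(3 \<Rightarrow> real^2) \<Rightarrow> 3 \<Rightarrow> real^2" where
  "tangent x k = (1 / norm (edge_vec x k)) *\<^sub>R edge_vec x k"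

definition normal :: "(3 \<Rightarrow> real^2) \<Rightarrow> 3 \<Rightarrow> real^2" where
  "normal x k = rot *v tangent x k"

section \<open>Affine diffeomorphisms and the double contravariant Piola map\<close>

text \<open>
  Functions on a set \<open>A\<close> are total functions of which only the values on \<open>A\<close> matter.
\<close>

definition affine_diffeo ::
  "(real^2 \<Rightarrow> real^2) \<Rightarrow> real^2^2 \<Rightarrow> (real^2) set \<Rightarrow> (real^2) set \<Rightarrow> bool" where
  "affine_diffeo F J A B \<longleftrightarrow>
     bij_betw F A B \<and> invertible J \<and> (\<exists>b. \<forall>y\<in>A. F y = J *v y + b)"

definition piola ::
  "(real^2 \<Rightarrow> real^2) \<Rightarrow> real^2^2 \<Rightarrow> (real^2) set \<Rightarrow> (real^2 \<Rightarrow> real^2^2) \<Rightarrow> (real^2 \<Rightarrow> real^2^2)" where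
  "piola F J A \<tau> = (\<lambda>y. (1 / (det J)\<^sup>2) *\<^sub>R (J ** \<tau> (inv_into A F y) ** transpose J))"

definition pushforward ::
  "((real^2 \<Rightarrow> real^2^2) \<Rightarrow> (real^2 \<Rightarrow> real^2^2)) \<Rightarrow>
   ((real^2 \<Rightarrow> real^2^2) \<Rightarrow> real) \<Rightarrow> ((real^2 \<Rightarrow> real^2^2) \<Rightarrow> real)" where
  "pushforward T l = l \<circ> T"

section \<open>The nonconforming Arnold--Winther space\<close>

text \<open>
  Polynomials of degree at most \<open>m\<close> on a subset of the plane, i.e. restrictions of polynomials in
  the two coordinates; on an edge this is the same as a polynomial of degree at most \<open>m\<close> in the
  arc length.
\<close>

definition poly_on :: "nat \<Rightarrow> (real^2) set \<Rightarrow> (real^2 \<Rightarrow> real) set" where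
  "poly_on m S = {f. \<exists>c :: nat \<Rightarrow> nat \<Rightarrow> real. \<forall>y\<in>S.
     f y = (\<Sum>i\<le>m. \<Sum>j\<le>m - i. c i j * (y $ 1) ^ i * (y $ 2) ^ j)}"

definition sym_poly_on :: "nat \<Rightarrow> (real^2) set \<Rightarrow> (real^2 \<Rightarrow> real^2^2) set" where
  "sym_poly_on m S = {\<tau>. (\<forall>y\<in>S. transpose (\<tau> y) = \<tau> y) \<and>
     (\<forall>i j. (\<lambda>y. \<tau> y $ i $ j) \<in> poly_on m S)}"

definition AWnc :: "(3 \<Rightarrow> real^2) \<Rightarrow> (real^2 \<Rightarrow> real^2^2) set" where
  "AWnc x = {\<tau> \<in> sym_poly_on 2 (tri x).
     \<forall>k. (\<lambda>y. normal x k \<bullet> (\<tau> y *v normal x k)) \<in> poly_on 1 (edge x k)}"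

definition basis_on ::
  "'a set \<Rightarrow> ('a \<Rightarrow> 'v::real_vector) set \<Rightarrow> ('i::finite \<Rightarrow> 'a \<Rightarrow> 'v) \<Rightarrow> bool" where
  "basis_on S V B \<longleftrightarrow> (\<forall>j. B j \<in> V) \<and>
     (\<forall>f\<in>V. \<exists>!c :: 'i \<Rightarrow> real. \<forall>y\<in>S. f y = (\<Sum>j\<in>UNIV. c j *\<^sub>R B j y))"

section \<open>Degrees of freedom\<close>

text \<open>
  The weights \<open>\<mu> 0, \<mu> 1\<close> (the numeral type 2 consists of 0 and 1) live on the unit interval.
\<close>

definition edge_weights :: "(2 \<Rightarrow> real \<Rightarrow> real) \<Rightarrow> bool" where
  "edge_weights \<mu> \<longleftrightarrow> (\<forall>\<theta>\<in>{0..1}. \<mu> 0 \<theta> = 1) \<and>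
     basis_on {0..1} {f. \<exists>p :: real poly. degree p \<le> 1 \<and> (\<forall>\<theta>\<in>{0..1}. f \<theta> = poly p \<theta>)} \<mu>"

text \<open>
  The arc length integral over an edge, in its affine parametrization from the lower- to the
  higher-numbered vertex, along which the weight is pulled back.
\<close>

definition dof_edge ::
  "(3 \<Rightarrow> real^2) \<Rightarrow> (real \<Rightarrow> real) \<Rightarrow> real^2 \<Rightarrow> 3 \<Rightarrow> (real^2 \<Rightarrow> real^2^2) \<Rightarrow> real" where
  "dof_edge x w s k \<tau> = integral {0..1} (\<lambda>\<theta>.
     (normal x k \<bullet> (\<tau> (x (lo k) + \<theta> *\<^sub>R edge_vec x k) *v s)) * w \<theta> * norm (edge_vec x k))"

definition dof_int :: "(3 \<Rightarrow> real^2) \<Rightarrow> 2 \<Rightarrow> 2 \<Rightarrow> (real^2 \<Rightarrow> real^2^2) \<Rightarrow> real" where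
  "dof_int x i j \<tau> = integral (tri x) (\<lambda>y. \<tau> y $ i $ j)"

text \<open>
  The 15 positions are arranged in blocks: \<open>Inl (k, a)\<close> is entry \<open>a\<close> of block \<open>k\<close> for
  \<open>k = 1, 2, 3\<close>, and \<open>Inr m\<close> is entry \<open>m\<close> of the fourth block. Entries of a block are numbered
  from 1.
\<close>

type_synonym idx = "(3 \<times> 4) + 3"

definition dofs ::
  "(3 \<Rightarrow> real^2) \<Rightarrow> (2 \<Rightarrow> real \<Rightarrow> real) \<Rightarrow> idx \<Rightarrow> (real^2 \<Rightarrow> real^2^2) \<Rightarrow> real" where
  "dofs x \<mu> r \<tau> = (case r of
     Inl (k, a) \<Rightarrow> (vector [dof_edge x (\<mu> 0) (normal x k) k \<tau>,
                           dof_edge x (\<mu> 0) (tangent x k) k \<tau>,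
                           dof_edge x (\<mu> 1) (normal x k) k \<tau>,
                           dof_edge x (\<mu> 1) (tangent x k) k \<tau>] :: real^4) $ a
   | Inr m \<Rightarrow> (vector [dof_int x 1 1 \<tau>, dof_int x 1 2 \<tau>, dof_int x 2 2 \<tau>] :: real^3) $ m)"

definition nodal_basis ::
  "(3 \<Rightarrow> real^2) \<Rightarrow> (2 \<Rightarrow> real \<Rightarrow> real) \<Rightarrow> (idx \<Rightarrow> real^2 \<Rightarrow> real^2^2) \<Rightarrow> bool" where
  "nodal_basis x \<mu> \<Psi> \<longleftrightarrow> basis_on (tri x) (AWnc x) \<Psi> \<and>
     (\<forall>i j. dofs x \<mu> i (\<Psi> j) = (if i = j then 1 else 0))"

section \<open>The transformation matrix\<close>

text \<open>
  A \<open>vector\<close> of vectors lists the rows of a matrix.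
\<close>

definition edge_coeffs :: "(3 \<Rightarrow> real^2) \<Rightarrow> real^2^2 \<Rightarrow> 3 \<Rightarrow> real^2" where
  "edge_coeffs xh J k = (1 / det J) *\<^sub>R
     (((vector [normal xh k, tangent xh k] :: real^2^2) ** transpose J ** J)
        *v tangent xh k)"

definition W_edge :: "(3 \<Rightarrow> real^2) \<Rightarrow> (3 \<Rightarrow> real^2) \<Rightarrow> real^2^2 \<Rightarrow> 3 \<Rightarrow> real^4^4" where
  "W_edge xh x J k =
     (let \<alpha> = edge_coeffs xh J k $ 1; \<beta> = edge_coeffs xh J k $ 2
      in (norm (edge_vec xh k) / norm (edge_vec x k)) *\<^sub>R
         vector [vector [1, 0, 0, 0],
                 vector [\<alpha>, \<beta>, 0, 0],
                 vector [0, 0, 1, 0],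
                 vector [0, 0, \<alpha>, \<beta>]])"

text \<open>
  This is the interior block with the factor \<open>1 / det J\<close>. The integral over the triangle picks up
  \<open>\<bar>det J\<bar>\<close> under the change of variables, so the block of the transformation matrix is
  \<open>sgn (det J) *\<^sub>R W_check J\<close>, with factor \<open>1 / \<bar>det J\<bar>\<close>. The sign is 1 when \<open>F\<close> preserves
  orientation; when \<open>F\<close> reverses it, the transformation formula is false without the sign
  (e.g. \<open>J = diag(-1, 1)\<close> and \<open>\<tau>\<close> constantly the identity matrix).
\<close>

definition W_check :: "real^2^2 \<Rightarrow> real^3^3" where
  "W_check J = (1 / det J) *\<^sub>R
     vector [vector [(J$1$1)\<^sup>2, 2 * J$1$1 * J$1$2, (J$1$2)\<^sup>2],
             vector [J$1$1 * J$2$1, J$1$1 * J$2$2 + J$1$2 * J$2$1, J$1$2 * J$2$2],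
             vector [(J$2$1)\<^sup>2, 2 * J$2$1 * J$2$2, (J$2$2)\<^sup>2]]"

definition block_diag :: "(3 \<Rightarrow> real^4^4) \<Rightarrow> real^3^3 \<Rightarrow> real^idx^idx" where
  "block_diag A B = (\<chi> r s. case (r, s) of
     (Inl (k, a), Inl (l, b)) \<Rightarrow> (if k = l then A k $ a $ b else 0)
   | (Inr m, Inr n) \<Rightarrow> B $ m $ n
   | _ \<Rightarrow> 0)"

end

theory Submission
  imports Defs
begin

text \<open>
  The edge functionals transform by the identity \<open>J\<^sup>T R J = det J R\<close> for the rotation \<open>R\<close>, which
  says that \<open>J\<^sup>T n\<close> is a multiple of the reference normal: with \<open>r = \<bar>eh\<bar> / \<bar>e\<bar>\<close> and \<open>J\<close> mapping edge
  vectors to edge vectors, \<open>J\<^sup>T n = r det J nh\<close>, while \<open>t = r J th\<close> (lemmas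
  \<open>normal_pullback\<close> and \<open>tangent_image\<close>, where \<open>nh, th\<close> are the reference normal and tangent). Thus
  \<open>n \<bullet> (T \<tau>) s = (r / det J) nh \<bullet> \<tau> (J\<^sup>T s)\<close> at corresponding points. For \<open>s = n\<close> this is
  \<open>r\<^sup>2 nh \<bullet> \<tau> nh\<close>; for \<open>s = t\<close> the vector \<open>J\<^sup>T J th\<close> is expanded in the orthonormal basis
  \<open>nh, th\<close>, and \<open>\<alpha>, \<beta>\<close> are its coordinates divided by \<open>det J\<close>. The arc length element absorbs one
  factor \<open>r\<close>, which leaves the edge blocks. The interior block is the entrywise form of
  \<open>\<tau> \<mapsto> J \<tau> J\<^sup>T\<close> on symmetric matrices, multiplied by \<open>\<bar>det J\<bar> / (det J)\<^sup>2\<close> from the change of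
  variables.

  The blocks are invertible: an edge block is lower triangular, with
  \<open>\<beta> = \<bar>J th\<bar>\<^sup>2 / det J \<noteq> 0\<close>, and \<open>J \<mapsto> W_check J\<close> is multiplicative, so \<open>W_check (matrix_inv J)\<close> inverts
  \<open>W_check J\<close>.

  The transformation of the nodal basis is duality. Since \<open>n \<bullet> (T \<tau>) n\<close> is a multiple of
  \<open>nh \<bullet> \<tau> nh\<close> and affine substitutions keep the degree, \<open>T\<close> maps the space on the reference triangle
  into the space on the image, and the same holds for the inverse map, so \<open>T\<close> is onto. Applying
  degree of freedom \<open>i\<close> on the image triangle to the \<open>j\<close>-th member of \<open>P\<^sup>T T(\<Psi>h)\<close> gives the entry
  \<open>(i, j)\<close> of \<open>W P = 1\<close>. A spanning family that is dual to the degrees of freedom is a nodal basis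
  (\<open>nodal_basisI\<close>), and there is only one (\<open>nodal_basis_unique\<close>).
\<close>

section \<open>Polynomials on subsets of the plane\<close>

lemma poly_on_cong:
  assumes "f \<in> poly_on m S" and "\<And>y. y \<in> S \<Longrightarrow> g y = f y"
  shows "g \<in> poly_on m S"
  using assms by (auto simp: poly_on_def)

lemma poly_on_add:
  assumes "f \<in> poly_on m S" and "g \<in> poly_on m S"
  shows "(\<lambda>y. f y + g y) \<in> poly_on m S"
proof -
  obtain c d where "\<forall>y\<in>S. f y = (\<Sum>i\<le>m. \<Sum>j\<le>m - i. c i j * (y $ 1) ^ i * (y $ 2) ^ j)"
    and "\<forall>y\<in>S. g y = (\<Sum>i\<le>m. \<Sum>j\<le>m - i. d i j * (y $ 1) ^ i * (y $ 2) ^ j)"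
    using assms by (auto simp: poly_on_def)
  then have "\<forall>y\<in>S. f y + g y = (\<Sum>i\<le>m. \<Sum>j\<le>m - i. (c i j + d i j) * (y $ 1) ^ i * (y $ 2) ^ j)"
    by (simp add: sum.distrib algebra_simps)
  then show ?thesis
    unfolding poly_on_def by (intro CollectI exI[of _ "\<lambda>i j. c i j + d i j"])
qed

lemma poly_on_scale:
  assumes "f \<in> poly_on m S"
  shows "(\<lambda>y. a * f y) \<in> poly_on m S"
proof -
  obtain c where "\<forall>y\<in>S. f y = (\<Sum>i\<le>m. \<Sum>j\<le>m - i. c i j * (y $ 1) ^ i * (y $ 2) ^ j)"
    using assms by (auto simp: poly_on_def)
  then have "\<forall>y\<in>S. a * f y = (\<Sum>i\<le>m. \<Sum>j\<le>m - i. (a * c i j) * (y $ 1) ^ i * (y $ 2) ^ j)"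
    by (simp add: sum_distrib_left algebra_simps)
  then show ?thesis
    unfolding poly_on_def by (intro CollectI exI[of _ "\<lambda>i j. a * c i j"])
qed

lemma poly_on_monomial:
  assumes "p + q \<le> m"
  shows "(\<lambda>y. a * (y $ 1) ^ p * (y $ 2) ^ q) \<in> poly_on m S"
proof -
  have "a * (y $ 1) ^ p * (y $ 2) ^ q =
      (\<Sum>i\<le>m. \<Sum>j\<le>m - i. (if i = p then if j = q then a else 0 else 0) * (y $ 1) ^ i * (y $ 2) ^ j)"
    for y :: "real^2"
  proof -
    let ?u = "a * (y $ 1) ^ p * (y $ 2) ^ q"
    have "(if i = p then if j = q then a else 0 else 0) * (y $ 1) ^ i * (y $ 2) ^ j
        = (if i = p then if j = q then ?u else 0 else 0)" for i j
      by simp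
    then have "(\<Sum>i\<le>m. \<Sum>j\<le>m - i. (if i = p then if j = q then a else 0 else 0) * (y $ 1) ^ i * (y $ 2) ^ j)
      = (\<Sum>i\<le>m. \<Sum>j\<le>m - i. if i = p then if j = q then ?u else 0 else 0)"
      by (simp only:)
    also have "\<dots> = (\<Sum>i\<le>m. if i = p then \<Sum>j\<le>m - i. if j = q then ?u else 0 else 0)"
      by (intro sum.cong refl) (simp split: if_split del: sum.delta)
    also have "\<dots> = (\<Sum>j\<le>m - p. if j = q then a * (y $ 1) ^ p * (y $ 2) ^ q else 0)"
      using assms by simp
    also have "\<dots> = a * (y $ 1) ^ p * (y $ 2) ^ q"
      using assms by simp
    finally show ?thesis ..
  qed
  then show ?thesis
    unfolding poly_on_def
    by (intro CollectI exI[of _ "\<lambda>i j. if i = p then if j = q then a else 0 else 0"]) blast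
qed

lemma poly_on_const: "(\<lambda>_. a) \<in> poly_on m S"
  using poly_on_monomial[of 0 0 m a S] by simp

lemma poly_on_sum:
  assumes "\<And>i. i \<in> I \<Longrightarrow> f i \<in> poly_on m S"
  shows "(\<lambda>y. \<Sum>i\<in>I. f i y) \<in> poly_on m S"
  using assms
proof (induction I rule: infinite_finite_induct)
  case (insert i I)
  then have "(\<lambda>y. f i y + (\<Sum>i\<in>I. f i y)) \<in> poly_on m S"
    by (intro poly_on_add) auto
  with insert.hyps show ?case by simp
qed (use poly_on_const in auto)

lemma poly_on_coord:
  assumes "m \<ge> 1"
  shows "(\<lambda>y. y $ i) \<in> poly_on m S"
  using exhaust_2[of i] poly_on_monomial[of 1 0 m 1 S] poly_on_monomial[of 0 1 m 1 S] assms
  by auto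

text \<open>
  A product of two monomials is a monomial; the two nested double sums are handled one factor at a
  time.
\<close>
lemma poly_on_mult:
  assumes "f \<in> poly_on a S" and "g \<in> poly_on b S"
  shows "(\<lambda>y. f y * g y) \<in> poly_on (a + b) S"
proof -
  have monomial: "(\<lambda>y. (u * (y $ 1) ^ p * (y $ 2) ^ q) * h y) \<in> poly_on (n + m) S"
    if pq: "p + q \<le> n" and h: "h \<in> poly_on m S" for u p q h n m
  proof -
    obtain c where c: "\<forall>y\<in>S. h y = (\<Sum>i\<le>m. \<Sum>j\<le>m - i. c i j * (y $ 1) ^ i * (y $ 2) ^ j)"
      using h by (auto simp: poly_on_def)
    have "(\<lambda>y. \<Sum>i\<le>m. \<Sum>j\<le>m - i. (u * c i j) * (y $ 1) ^ (p + i) * (y $ 2) ^ (q + j))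
        \<in> poly_on (n + m) S"
      using pq by (intro poly_on_sum poly_on_monomial) auto
    then show ?thesis
      by (rule poly_on_cong) (simp add: c sum_distrib_left power_add algebra_simps)
  qed
  obtain c where c: "\<forall>y\<in>S. f y = (\<Sum>i\<le>a. \<Sum>j\<le>a - i. c i j * (y $ 1) ^ i * (y $ 2) ^ j)"
    using assms(1) by (auto simp: poly_on_def)
  have "(\<lambda>y. \<Sum>i\<le>a. \<Sum>j\<le>a - i. (c i j * (y $ 1) ^ i * (y $ 2) ^ j) * g y) \<in> poly_on (a + b) S"
    using assms(2) by (intro poly_on_sum monomial) auto
  then show ?thesis
    by (rule poly_on_cong) (simp add: c sum_distrib_right)
qed

lemma poly_on_power:
  assumes "f \<in> poly_on 1 S"
  shows "(\<lambda>y. f y ^ n) \<in> poly_on n S"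
proof (induction n)
  case 0
  then show ?case using poly_on_const[of 1] by simp
next
  case (Suc n)
  then show ?case using poly_on_mult[OF assms Suc] by simp
qed

lemma poly_on_mono:
  assumes "f \<in> poly_on m S" and "m \<le> n"
  shows "f \<in> poly_on n S"
  using poly_on_mult[OF assms(1) poly_on_const[of 1 "n - m"]] assms(2) by simp

text \<open>
  The coordinates of \<open>g\<close> have degree at most 1, so substituting them in a monomial of degree at most
  \<open>m\<close> gives a product of degree at most \<open>m\<close>.
\<close>
lemma poly_on_affine_compose:
  assumes "f \<in> poly_on m S" and "\<And>y. y \<in> S' \<Longrightarrow> g y \<in> S"
    and g: "\<And>y. y \<in> S' \<Longrightarrow> g y = A *v y + b"
  shows "(\<lambda>y. f (g y)) \<in> poly_on m S'"
proof -
  obtain c where c: "\<forall>y\<in>S. f y = (\<Sum>i\<le>m. \<Sum>j\<le>m - i. c i j * (y $ 1) ^ i * (y $ 2) ^ j)"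
    using assms(1) by (auto simp: poly_on_def)
  have coord: "(\<lambda>y. g y $ i) \<in> poly_on 1 S'" for i
  proof -
    have "(\<lambda>y. (\<Sum>j\<in>UNIV. A $ i $ j * y $ j) + b $ i) \<in> poly_on 1 S'"
      by (intro poly_on_add poly_on_sum poly_on_scale poly_on_const poly_on_coord) simp
    then show ?thesis
      by (rule poly_on_cong) (simp add: g matrix_vector_mult_def)
  qed
  have "(\<lambda>y. \<Sum>i\<le>m. \<Sum>j\<le>m - i. c i j * ((g y $ 1) ^ i * (g y $ 2) ^ j)) \<in> poly_on m S'"
    by (intro poly_on_sum poly_on_scale poly_on_mono[OF poly_on_mult[OF poly_on_power poly_on_power]]
      coord) auto
  then show ?thesis
    by (rule poly_on_cong) (simp add: c assms(2) mult.assoc)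
qed

lemma poly_on_continuous:
  assumes "f \<in> poly_on m S"
  shows "continuous_on S f"
proof -
  obtain c where c: "\<forall>y\<in>S. f y = (\<Sum>i\<le>m. \<Sum>j\<le>m - i. c i j * (y $ 1) ^ i * (y $ 2) ^ j)"
    using assms by (auto simp: poly_on_def)
  have "continuous_on S (\<lambda>y::real^2. \<Sum>i\<le>m. \<Sum>j\<le>m - i. c i j * (y $ 1) ^ i * (y $ 2) ^ j)"
    by (intro continuous_intros)
  then show ?thesis
    by (rule continuous_on_eq) (simp add: c)
qed

section \<open>Integrals over affine images\<close>

lemma compact_continuous_absolutely_integrable:
  fixes g :: "'a::euclidean_space \<Rightarrow> 'b::euclidean_space"
  assumes "compact S" and "continuous_on S g"
  shows "g absolutely_integrable_on S"
proof -
  have "integrable lborel (\<lambda>y. indicator S y *\<^sub>R g y)"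
    by (rule borel_integrable_compact[OF assms])
  then show ?thesis
    unfolding set_integrable_def
    by (subst integrable_completion) (auto dest: borel_measurable_integrable)
qed

text \<open>
  The change of variables formula takes vector-valued integrands; \<open>g\<close> enters it as a function into
  \<open>real^1\<close>.
\<close>
lemma integral_affine_image:
  fixes J :: "real^2^2" and g :: "real^2 \<Rightarrow> real"
  assumes "compact S" and F: "\<And>y. y \<in> S \<Longrightarrow> F y = J *v y + b" and inj: "inj_on F S"
    and "continuous_on (F ` S) g"
  shows "integral (F ` S) g = \<bar>det J\<bar> * integral S (\<lambda>y. g (F y))"
proof -
  let ?g = "\<lambda>y. vec (g y) :: real^1"
  have der: "(F has_derivative (*v) J) (at y within S)" if "y \<in> S" for y
  proof -
    have "((\<lambda>y. J *v y + b) has_derivative (*v) J) (at y within S)"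
      by (auto intro!: derivative_eq_intros bounded_linear_imp_has_derivative)
    then show ?thesis
      by (rule has_derivative_transform[OF that _, rotated]) (simp add: F)
  qed
  have "continuous_on S F"
    using der by (rule has_derivative_continuous_on)
  then have "compact (F ` S)"
    using \<open>compact S\<close> by (rule compact_continuous_image)
  then have "?g absolutely_integrable_on F ` S"
    using assms(4) by (intro compact_continuous_absolutely_integrable) (simp_all add: vec_def continuous_on_vec_lambda)
  moreover have "S \<in> sets lebesgue"
    using \<open>compact S\<close> by (simp add: borel_compact)
  ultimately have "integral (F ` S) ?g = integral S (\<lambda>y. \<bar>det J\<bar> *\<^sub>R ?g (F y))"
    using integral_change_of_variables[OF _ der inj, of ?g]  by simp
  then have "integral (F ` S) ?g $ 1 = integral S (\<lambda>y. \<bar>det J\<bar> *\<^sub>R ?g (F y)) $ 1"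
    by simp
  then show ?thesis by (simp add: integral_on_1_eq o_def)
qed

section \<open>Block diagonal matrices\<close>

lemma vector_4:
  "(vector [a, b, c, d] :: 'a::zero^4) $ 1 = a"
  "(vector [a, b, c, d] :: 'a::zero^4) $ 2 = b"
  "(vector [a, b, c, d] :: 'a::zero^4) $ 3 = c"
  "(vector [a, b, c, d] :: 'a::zero^4) $ 4 = d"
  unfolding vector_def by simp_all

lemma sum_idx:
  fixes f :: "idx \<Rightarrow> 'a::comm_monoid_add"
  shows "(\<Sum>r\<in>UNIV. f r) = (\<Sum>k\<in>UNIV. \<Sum>a\<in>UNIV. f (Inl (k, a))) + (\<Sum>m\<in>UNIV. f (Inr m))"
proof -
  have "(\<Sum>r\<in>UNIV. f r) = (\<Sum>p\<in>UNIV. f (Inl p)) + (\<Sum>m\<in>UNIV. f (Inr m))"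
    unfolding UNIV_Plus_UNIV[symmetric] by (subst sum.Plus) auto
  also have "(\<Sum>p\<in>UNIV. f (Inl p)) = (\<Sum>k\<in>UNIV. \<Sum>a\<in>UNIV. f (Inl (k, a)))"
    unfolding UNIV_Times_UNIV[symmetric] sum.cartesian_product by simp
  finally show ?thesis .
qed

lemma block_diag_nth [simp]:
  "block_diag A B $ Inl (k, a) $ Inl (l, b) = (if k = l then A k $ a $ b else 0)"
  "block_diag A B $ Inl p $ Inr n = 0"
  "block_diag A B $ Inr m $ Inl q = 0"
  "block_diag A B $ Inr m $ Inr n = B $ m $ n"
  by (auto simp: block_diag_def split: prod.split)

lemma block_diag_mult_vec:
  "(block_diag A B *v v) $ Inl (k, a) = (\<Sum>b\<in>UNIV. A k $ a $ b * v $ Inl (k, b))"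
  "(block_diag A B *v v) $ Inr m = (\<Sum>n\<in>UNIV. B $ m $ n * v $ Inr n)"
proof -
  have "(block_diag A B *v v) $ Inl (k, a)
      = (\<Sum>l\<in>UNIV. if k = l then \<Sum>b\<in>UNIV. A k $ a $ b * v $ Inl (k, b) else 0)"
    by (simp add: matrix_vector_mult_def sum_idx del: sum.delta sum.delta')
      (intro sum.cong refl, auto)
  then show "(block_diag A B *v v) $ Inl (k, a) = (\<Sum>b\<in>UNIV. A k $ a $ b * v $ Inl (k, b))"
    by simp
  show "(block_diag A B *v v) $ Inr m = (\<Sum>n\<in>UNIV. B $ m $ n * v $ Inr n)"
    by (simp add: matrix_vector_mult_def sum_idx)
qed

lemma block_diag_mult:
  "block_diag A B ** block_diag A' B' = block_diag (\<lambda>k. A k ** A' k) (B ** B')"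
proof -
  have "(block_diag A B ** block_diag A' B') $ r $ s = block_diag (\<lambda>k. A k ** A' k) (B ** B') $ r $ s"
    for r s
  proof -
    have col: "(block_diag A B ** block_diag A' B') $ r $ s
        = (block_diag A B *v column s (block_diag A' B')) $ r"
      by (simp add: matrix_matrix_mult_def matrix_vector_mult_def column_def)
    show ?thesis
      unfolding col
      by (cases r; cases s)
        (auto simp: block_diag_mult_vec column_def matrix_matrix_mult_def)
  qed
  then show ?thesis by (simp add: vec_eq_iff)
qed

lemma block_diag_mat_1: "block_diag (\<lambda>_. mat 1) (mat 1) = mat 1"
  by (auto simp: vec_eq_iff mat_def block_diag_def split: sum.split prod.split)

lemma matrix_inv_mult:
  fixes A :: "'a::field^'n^'n"
  assumes "invertible A"
  shows "matrix_inv A ** A = mat 1" and "A ** matrix_inv A = mat 1"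
  using someI_ex[OF assms[unfolded invertible_def]] unfolding matrix_inv_def by auto

lemma matrix_inv_eqI:
  fixes A B :: "'a::field^'n^'n"
  assumes "A ** B = mat 1"
  shows "invertible A" and "matrix_inv A = B"
proof -
  show A: "invertible A"
    using assms invertible_right_inverse by blast
  have "matrix_inv A = matrix_inv A ** (A ** B)"
    using assms by simp
  also have "\<dots> = B"
    using matrix_inv_mult[OF A] by (simp add: matrix_mul_assoc)
  finally show "matrix_inv A = B" .
qed

lemma block_diag_inverse:
  assumes "\<And>k. invertible (A k)" and "invertible B"
  shows "invertible (block_diag A B)"
    and "matrix_inv (block_diag A B) = block_diag (\<lambda>k. matrix_inv (A k)) (matrix_inv B)"
proof -
  have "block_diag A B ** block_diag (\<lambda>k. matrix_inv (A k)) (matrix_inv B) = mat 1"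
    by (simp add: block_diag_mult matrix_inv_mult assms block_diag_mat_1)
  then show "invertible (block_diag A B)"
    and "matrix_inv (block_diag A B) = block_diag (\<lambda>k. matrix_inv (A k)) (matrix_inv B)"
    by (rule matrix_inv_eqI)+
qed

section \<open>Degrees of freedom\<close>

lemma linear_congruence: "linear (\<lambda>A::real^2^2. B ** A ** C)"
  by (rule linearI) (simp_all add: vec_eq_iff forall_2 sum_2 matrix_matrix_mult_def algebra_simps)

lemma linear_entry: "linear (\<lambda>A::real^2^2. A $ i $ j)"
  by (rule linearI) simp_all

lemma linear_matrix_pairing: "linear (\<lambda>A::real^2^2. u \<bullet> (A *v v))"
  by (rule linearI) (simp_all add: inner_vec_def sum_2 matrix_vector_mult_def algebra_simps)

lemma tri_compact: "compact (tri x)"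
  unfolding tri_def by (intro finite_imp_compact_convex_hull) simp

lemma edge_subset_tri: "edge x k \<subseteq> tri x"
  unfolding edge_def tri_def by (simp add: closed_segment_subset_convex_hull hull_inc)

lemma edge_point:
  "x (lo k) + \<theta> *\<^sub>R edge_vec x k = (1 - \<theta>) *\<^sub>R x (lo k) + \<theta> *\<^sub>R x (hi k)"
  by (simp add: edge_vec_def algebra_simps)

lemma edge_eq_image: "edge x k = (\<lambda>\<theta>. x (lo k) + \<theta> *\<^sub>R edge_vec x k) ` {0..1}"
  unfolding edge_def edge_point by (auto simp: closed_segment_def)

lemma lo_hi:
  "lo 1 = 2" "lo 2 = 1" "lo 3 = 1" "hi 1 = 3" "hi 2 = 3" "hi 3 = 2"
  by (simp_all add: lo_def hi_def)

text \<open>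
  In this form a vanishing edge leaves at most two distinct vertices, which are collinear.
\<close>
lemma UNIV_opposite_edge: "UNIV = {k, lo k, hi k}"
proof -
  consider "k = 1" | "k = 2" | "k = 3" using exhaust_3 by blast
  then show ?thesis
    by cases (simp_all only: lo_hi UNIV_3, auto)
qed

lemma edge_vec_nonzero:
  assumes "nondegenerate x"
  shows "edge_vec x k \<noteq> 0"
proof
  assume "edge_vec x k = 0"
  then have "range x = {x k, x (lo k)}"
    unfolding UNIV_opposite_edge[of k] by (simp add: edge_vec_def)
  with assms show False
    by (simp add: nondegenerate_def)
qed

lemma AWnc_continuous:
  assumes "\<tau> \<in> AWnc x"
  shows "continuous_on (tri x) \<tau>"
proof -
  have "continuous_on (tri x) (\<lambda>y. \<tau> y $ i $ j)" for i j
    using assms by (intro poly_on_continuous[of _ 2]) (simp add: AWnc_def sym_poly_on_def)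
  then have "continuous_on (tri x) (\<lambda>y. \<chi> i j. \<tau> y $ i $ j)"
    by (intro continuous_on_vec_lambda)
  then show ?thesis by simp
qed

lemma AWnc_sum:
  assumes "\<And>i. i \<in> I \<Longrightarrow> \<tau> i \<in> AWnc x"
  shows "(\<lambda>y. \<Sum>i\<in>I. c i *\<^sub>R \<tau> i y) \<in> AWnc x"
proof -
  have "(\<lambda>y. \<Sum>i\<in>I. c i * \<tau> i y $ a $ b) \<in> poly_on 2 (tri x)" for a b
    using assms by (intro poly_on_sum poly_on_scale) (auto simp: AWnc_def sym_poly_on_def)
  moreover have "transpose (\<Sum>i\<in>I. c i *\<^sub>R \<tau> i y) = (\<Sum>i\<in>I. c i *\<^sub>R \<tau> i y)" if "y \<in> tri x" for y
  proof -
    have "\<tau> i y $ a $ b = \<tau> i y $ b $ a" if "i \<in> I" for i a b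
    proof -
      have "transpose (\<tau> i y) $ a $ b = \<tau> i y $ a $ b"
        using assms[OF that] \<open>y \<in> tri x\<close> by (simp add: AWnc_def sym_poly_on_def)
      then show ?thesis by (simp add: transpose_def)
    qed
    then show ?thesis
      by (simp add: vec_eq_iff transpose_def)
  qed
  moreover have "(\<lambda>y. normal x k \<bullet> ((\<Sum>i\<in>I. c i *\<^sub>R \<tau> i y) *v normal x k)) \<in> poly_on 1 (edge x k)" for k
  proof -
    have "(\<lambda>y. \<Sum>i\<in>I. c i * (normal x k \<bullet> (\<tau> i y *v normal x k))) \<in> poly_on 1 (edge x k)"
      using assms by (intro poly_on_sum poly_on_scale) (auto simp: AWnc_def)
    then show ?thesis
      by (rule poly_on_cong)
        (simp add: linear_sum[OF linear_matrix_pairing] linear_cmul[OF linear_matrix_pairing])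
  qed
  ultimately show ?thesis
    by (simp add: AWnc_def sym_poly_on_def)
qed

lemma edge_integrand_continuous:
  fixes \<tau> :: "real^2 \<Rightarrow> real^2^2"
  assumes "continuous_on (tri x) \<tau>" and "continuous_on {0..1} w"
  shows "continuous_on {0..1} (\<lambda>\<theta>. (u \<bullet> (\<tau> (x (lo k) + \<theta> *\<^sub>R edge_vec x k) *v s)) * w \<theta> * c)"
proof -
  have "(\<lambda>\<theta>. x (lo k) + \<theta> *\<^sub>R edge_vec x k) ` {0..1} \<subseteq> tri x"
    using edge_subset_tri[of x k] by (simp add: edge_eq_image)
  then have "continuous_on {0..1} (\<lambda>\<theta>. \<tau> (x (lo k) + \<theta> *\<^sub>R edge_vec x k))"
    by (intro continuous_on_compose2[OF assms(1)] continuous_intros) auto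
  then have "continuous_on {0..1} (\<lambda>\<theta>. u \<bullet> (\<tau> (x (lo k) + \<theta> *\<^sub>R edge_vec x k) *v s))"
    by (rule linear_continuous_on_compose[OF _ linear_matrix_pairing])
  with assms(2) show ?thesis
    by (intro continuous_on_mult continuous_on_const)
qed

lemma dof_edge_sum:
  assumes "finite I" and "\<And>i. i \<in> I \<Longrightarrow> continuous_on (tri x) (\<tau> i)" and "continuous_on {0..1} w"
  shows "dof_edge x w s k (\<lambda>y. \<Sum>i\<in>I. c i *\<^sub>R \<tau> i y) = (\<Sum>i\<in>I. c i * dof_edge x w s k (\<tau> i))"
proof -
  let ?f = "\<lambda>i \<theta>. (normal x k \<bullet> (\<tau> i (x (lo k) + \<theta> *\<^sub>R edge_vec x k) *v s)) * w \<theta> * norm (edge_vec x k)"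
  have "dof_edge x w s k (\<lambda>y. \<Sum>i\<in>I. c i *\<^sub>R \<tau> i y) = integral {0..1} (\<lambda>\<theta>. \<Sum>i\<in>I. c i * ?f i \<theta>)"
    unfolding dof_edge_def
    by (simp add: linear_sum[OF linear_matrix_pairing] linear_cmul[OF linear_matrix_pairing]
        sum_distrib_right mult.assoc)
  also have "\<dots> = (\<Sum>i\<in>I. integral {0..1} (\<lambda>\<theta>. c i * ?f i \<theta>))"
    using assms
    by (intro integral_sum integrable_on_mult_right integrable_continuous_interval
        edge_integrand_continuous) auto
  finally show ?thesis
    by (simp add: dof_edge_def)
qed

lemma entry_integrable:
  fixes \<tau> :: "real^2 \<Rightarrow> real^2^2"
  assumes "continuous_on (tri x) \<tau>"
  shows "(\<lambda>y. \<tau> y $ a $ b) integrable_on tri x"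
  using compact_continuous_absolutely_integrable[OF tri_compact
      linear_continuous_on_compose[OF assms linear_entry]]
  by (rule set_lebesgue_integral_eq_integral)

lemma dof_int_sum:
  assumes "finite I" and "\<And>i. i \<in> I \<Longrightarrow> continuous_on (tri x) (\<tau> i)"
  shows "dof_int x a b (\<lambda>y. \<Sum>i\<in>I. c i *\<^sub>R \<tau> i y) = (\<Sum>i\<in>I. c i * dof_int x a b (\<tau> i))"
proof -
  have "(\<lambda>y. \<tau> i y $ a $ b) integrable_on tri x" if "i \<in> I" for i
    by (rule entry_integrable[OF assms(2)[OF that]])
  then show ?thesis
    using assms(1) by (simp add: dof_int_def integral_sum integrable_on_mult_right)
qed

lemma edge_weights_continuous:
  assumes "edge_weights \<mu>"
  shows "continuous_on {0..1} (\<mu> i)"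
proof -
  obtain p where "\<forall>\<theta>\<in>{0..1}. \<mu> i \<theta> = poly p \<theta>"
    using assms unfolding edge_weights_def basis_on_def by blast
  moreover have "continuous_on {0..1} (poly p)"
    by (intro continuous_intros)
  ultimately show ?thesis
    by (metis continuous_on_eq)
qed

lemma dofs_cases:
  "dofs x \<mu> (Inl (k, 1)) = dof_edge x (\<mu> 0) (normal x k) k"
  "dofs x \<mu> (Inl (k, 2)) = dof_edge x (\<mu> 0) (tangent x k) k"
  "dofs x \<mu> (Inl (k, 3)) = dof_edge x (\<mu> 1) (normal x k) k"
  "dofs x \<mu> (Inl (k, 4)) = dof_edge x (\<mu> 1) (tangent x k) k"
  "dofs x \<mu> (Inr 1) = dof_int x 1 1"
  "dofs x \<mu> (Inr 2) = dof_int x 1 2"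
  "dofs x \<mu> (Inr 3) = dof_int x 2 2"
  by (auto simp: dofs_def vector_4)

text \<open>
  Linearity and locality need not be proved for each of the 15 functionals: two integral shapes
  cover them all.
\<close>
lemma dofs_property:
  assumes "\<And>w s k. w \<in> range \<mu> \<Longrightarrow> Q (dof_edge x w s k)" and "\<And>a b. Q (dof_int x a b)"
  shows "Q (dofs x \<mu> r)"
proof (cases r)
  case (Inl p)
  moreover obtain k a where "p = (k, a)" by force
  ultimately show ?thesis
    using exhaust_4[of a] assms(1) by (auto simp: dofs_cases)
next
  case (Inr m)
  then show ?thesis
    using exhaust_3[of m] assms(2) by (auto simp: dofs_cases)
qed

lemma dofs_sum:
  assumes "edge_weights \<mu>" and "finite I" and "\<And>i. i \<in> I \<Longrightarrow> \<tau> i \<in> AWnc x"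
  shows "dofs x \<mu> r (\<lambda>y. \<Sum>i\<in>I. c i *\<^sub>R \<tau> i y) = (\<Sum>i\<in>I. c i * dofs x \<mu> r (\<tau> i))"
proof (rule dofs_property)
  show "dof_edge x w s k (\<lambda>y. \<Sum>i\<in>I. c i *\<^sub>R \<tau> i y) = (\<Sum>i\<in>I. c i * dof_edge x w s k (\<tau> i))"
    if "w \<in> range \<mu>" for w s k
    using assms that by (intro dof_edge_sum) (auto intro: AWnc_continuous edge_weights_continuous)
  show "dof_int x a b (\<lambda>y. \<Sum>i\<in>I. c i *\<^sub>R \<tau> i y) = (\<Sum>i\<in>I. c i * dof_int x a b (\<tau> i))" for a b
    using assms by (intro dof_int_sum) (auto intro: AWnc_continuous)
qed

lemma dofs_cong:
  assumes "\<And>y. y \<in> tri x \<Longrightarrow> \<sigma> y = \<tau> y"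
  shows "dofs x \<mu> r \<sigma> = dofs x \<mu> r \<tau>"
proof (rule dofs_property)
  show "dof_edge x w s k \<sigma> = dof_edge x w s k \<tau>" for w s k
    unfolding dof_edge_def using edge_subset_tri[of x k] assms
    by (intro integral_cong) (auto simp: edge_eq_image image_subset_iff)
  show "dof_int x a b \<sigma> = dof_int x a b \<tau>" for a b
    unfolding dof_int_def by (intro integral_cong) (simp add: assms)
qed

section \<open>Nodal bases\<close>

text \<open>
  Applying the dual functionals to the expansion in the basis reads off its coefficients.
\<close>
lemma nodal_basis_expansion:
  assumes "edge_weights \<mu>" and \<Psi>: "nodal_basis x \<mu> \<Psi>" and "\<tau> \<in> AWnc x" and "y \<in> tri x"
  shows "\<tau> y = (\<Sum>j\<in>UNIV. dofs x \<mu> j \<tau> *\<^sub>R \<Psi> j y)"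
proof -
  obtain c where c: "\<forall>y\<in>tri x. \<tau> y = (\<Sum>j\<in>UNIV. c j *\<^sub>R \<Psi> j y)"
    using \<Psi> \<open>\<tau> \<in> AWnc x\<close> unfolding nodal_basis_def basis_on_def by blast
  have "dofs x \<mu> i \<tau> = c i" for i
  proof -
    have "dofs x \<mu> i \<tau> = dofs x \<mu> i (\<lambda>y. \<Sum>j\<in>UNIV. c j *\<^sub>R \<Psi> j y)"
      using c by (intro dofs_cong) simp
    also have "\<dots> = (\<Sum>j\<in>UNIV. c j * dofs x \<mu> i (\<Psi> j))"
      using assms(1) \<Psi> by (intro dofs_sum) (auto simp: nodal_basis_def basis_on_def)
    also have "\<dots> = (\<Sum>j\<in>UNIV. if i = j then c j else 0)"
      using \<Psi> by (intro sum.cong) (auto simp: nodal_basis_def)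
    also have "\<dots> = c i"
      by simp
    finally show ?thesis .
  qed
  with c \<open>y \<in> tri x\<close> show ?thesis by simp
qed

text \<open>
  Duality alone determines the coefficients of an expansion, so only existence has to be supplied.
\<close>
lemma nodal_basisI:
  assumes "edge_weights \<mu>" and \<Psi>: "\<And>j. \<Psi> j \<in> AWnc x"
    and dual: "\<And>i j. dofs x \<mu> i (\<Psi> j) = (if i = j then 1 else 0)"
    and span: "\<And>\<tau>. \<tau> \<in> AWnc x \<Longrightarrow> \<exists>c. \<forall>y\<in>tri x. \<tau> y = (\<Sum>j\<in>UNIV. c j *\<^sub>R \<Psi> j y)"
  shows "nodal_basis x \<mu> \<Psi>"
proof -
  have coeff: "c i = dofs x \<mu> i \<tau>" if "\<forall>y\<in>tri x. \<tau> y = (\<Sum>j\<in>UNIV. c j *\<^sub>R \<Psi> j y)" for c \<tau> i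
  proof -
    have "dofs x \<mu> i \<tau> = dofs x \<mu> i (\<lambda>y. \<Sum>j\<in>UNIV. c j *\<^sub>R \<Psi> j y)"
      using that by (intro dofs_cong) simp
    also have "\<dots> = (\<Sum>j\<in>UNIV. c j * dofs x \<mu> i (\<Psi> j))"
      using assms(1) \<Psi> by (intro dofs_sum) auto
    also have "\<dots> = (\<Sum>j\<in>UNIV. if i = j then c j else 0)"
      by (intro sum.cong) (auto simp: dual)
    also have "\<dots> = c i"
      by simp
    finally show ?thesis ..
  qed
  have "\<exists>!c. \<forall>y\<in>tri x. \<tau> y = (\<Sum>j\<in>UNIV. c j *\<^sub>R \<Psi> j y)" if "\<tau> \<in> AWnc x" for \<tau>
  proof (rule ex_ex1I[OF span[OF that]])
    fix c d
    assume "\<forall>y\<in>tri x. \<tau> y = (\<Sum>j\<in>UNIV. c j *\<^sub>R \<Psi> j y)"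
      and "\<forall>y\<in>tri x. \<tau> y = (\<Sum>j\<in>UNIV. d j *\<^sub>R \<Psi> j y)"
    from this[THEN coeff] show "c = d"
      by (intro ext) simp
  qed
  with \<Psi> dual show ?thesis
    by (simp add: nodal_basis_def basis_on_def)
qed

text \<open>
  Both bases have the same values under the degrees of freedom, and those determine a member of the
  space.
\<close>
lemma nodal_basis_unique:
  assumes weights: "edge_weights \<mu>" and \<Phi>: "nodal_basis x \<mu> \<Phi>" and \<Psi>: "nodal_basis x \<mu> \<Psi>"
    and "y \<in> tri x"
  shows "\<Psi> j y = \<Phi> j y"
proof -
  have "\<Psi> j y = (\<Sum>i\<in>UNIV. dofs x \<mu> i (\<Psi> j) *\<^sub>R \<Phi> i y)"
    using \<Psi> by (intro nodal_basis_expansion[OF weights \<Phi> _ assms(4)]) (auto simp: nodal_basis_def basis_on_def)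
  also have "\<dots> = (\<Sum>i\<in>UNIV. if i = j then \<Phi> i y else 0)"
    using \<Psi> by (intro sum.cong) (auto simp: nodal_basis_def)
  finally show ?thesis by simp
qed


section \<open>The Piola map between two triangles\<close>

text \<open>Transposes stay on the left of \<open>*v\<close>, in the form of the pullback \<open>J\<^sup>T n\<close>.\<close>
declare transpose_matrix_vector [simp del]

lemma vertex_in_tri: "x i \<in> tri x"
  unfolding tri_def by (simp add: hull_inc)

lemma scaleR_matrix_vector: "(c *\<^sub>R A) *v (v::real^'n) = c *\<^sub>R (A *v v)"
  by (simp add: scaleR_matrix_vector_assoc)

lemma rot_orthonormal_expansion:
  assumes "norm t = 1"
  shows "v = ((rot *v t) \<bullet> v) *\<^sub>R (rot *v t) + (t \<bullet> v) *\<^sub>R t"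
proof -
  have t: "t $ 1 * t $ 1 + t $ 2 * t $ 2 = 1"
    using assms by (simp add: norm_eq_1 inner_vec_def sum_2)
  have "t $ 2 * v $ 1 * t $ 2 + t $ 1 * v $ 1 * t $ 1 = v $ 1 * (t $ 1 * t $ 1 + t $ 2 * t $ 2)"
    "t $ 2 * v $ 2 * t $ 2 + t $ 1 * v $ 2 * t $ 1 = v $ 2 * (t $ 1 * t $ 1 + t $ 2 * t $ 2)"
    by (simp_all add: algebra_simps)
  then show ?thesis
    by (simp add: vec_eq_iff forall_2 sum_2 inner_vec_def matrix_vector_mult_def rot_def t algebra_simps)
qed

text \<open>
  In the plane, the rotation conjugates a matrix into its cofactor matrix:
  \<open>J\<^sup>T R J = det J R\<close>. This makes normals pull back to normals, with a factor that has the sign of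
  the orientation of \<open>J\<close>.
\<close>
lemma rot_cofactor: "transpose J *v (rot *v (J *v v)) = det J *\<^sub>R (rot *v v)"
  by (simp add: vec_eq_iff forall_2 sum_2 matrix_vector_mult_def rot_def det_2 transpose_def
      algebra_simps)

text \<open>
  \<open>W_check J\<close> represents \<open>\<tau> \<mapsto> J \<tau> J\<^sup>T / det J\<close> in the entries \<open>11, 12, 22\<close> of a symmetric matrix, and
  composing two such maps multiplies the matrices \<open>J\<close>.
\<close>
lemma W_check_mult: "W_check (A ** B) = W_check A ** W_check B"
proof -
  define N :: "real^2^2 \<Rightarrow> real^3^3" where
    "N J = vector [vector [(J$1$1)\<^sup>2, 2 * J$1$1 * J$1$2, (J$1$2)\<^sup>2],
             vector [J$1$1 * J$2$1, J$1$1 * J$2$2 + J$1$2 * J$2$1, J$1$2 * J$2$2],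
             vector [(J$2$1)\<^sup>2, 2 * J$2$1 * J$2$2, (J$2$2)\<^sup>2]]" for J
  have "N (A ** B) = N A ** N B"
    by (simp add: vec_eq_iff forall_3 sum_3 sum_2 N_def matrix_matrix_mult_def power2_eq_square
        algebra_simps)
  moreover have W: "W_check J = (1 / det J) *\<^sub>R N J" for J
    by (simp add: W_check_def N_def)
  ultimately show ?thesis
    by (simp add: W det_mul matrix_scalar_ac scalar_matrix_assoc[symmetric] mult.commute)
qed

lemma W_check_1: "W_check (mat 1) = mat 1"
  unfolding W_check_def det_I by (simp add: vec_eq_iff forall_3 mat_def)

text \<open>
  Both triangles are kept as parameters so that the locale can be interpreted again for the inverse
  map; everything shown about \<open>F\<close> then also holds for its inverse.
\<close>
locale triangle_map =
  fixes xh x :: "3 \<Rightarrow> real^2" and F :: "real^2 \<Rightarrow> real^2" and J :: "real^2^2"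
  assumes nondegenerate_source: "nondegenerate xh" and nondegenerate_target: "nondegenerate x"
    and affine: "affine_diffeo F J (tri xh) (tri x)"
    and vertices: "F (xh i) = x i"
begin

abbreviation T :: "(real^2 \<Rightarrow> real^2^2) \<Rightarrow> real^2 \<Rightarrow> real^2^2" where
  "T \<equiv> piola F J (tri xh)"

definition ratio :: "3 \<Rightarrow> real" where
  "ratio k = norm (edge_vec xh k) / norm (edge_vec x k)"

lemma ratio_nonzero: "ratio k \<noteq> 0"
  using edge_vec_nonzero nondegenerate_source nondegenerate_target by (simp add: ratio_def)

lemma invertible_J: "invertible J"
  using affine by (simp add: affine_diffeo_def)

lemma det_nonzero: "det J \<noteq> 0"
  using invertible_J invertible_det_nz by blast

lemma bij: "bij_betw F (tri xh) (tri x)"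
  using affine by (simp add: affine_diffeo_def)

lemma inj: "inj_on F (tri xh)" and image: "F ` tri xh = tri x"
  using bij by (auto simp: bij_betw_def)

definition shift :: "real^2" where
  "shift = x 1 - J *v xh 1"

lemma affine_form:
  assumes "y \<in> tri xh"
  shows "F y = J *v y + shift"
proof -
  obtain b where b: "\<forall>y\<in>tri xh. F y = J *v y + b"
    using affine unfolding affine_diffeo_def by blast
  with vertex_in_tri[of xh 1] have "x 1 = J *v xh 1 + b"
    by (simp flip: vertices)
  with b assms show ?thesis
    by (simp add: shift_def)
qed

lemma edge_vec_image: "edge_vec x k = J *v edge_vec xh k"
proof -
  have "x i = J *v xh i + shift" for i
    using affine_form[OF vertex_in_tri] by (simp add: vertices)
  then show ?thesis
    by (simp add: edge_vec_def matrix_vector_mult_diff_distrib)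
qed

lemma edge_param_in_tri:
  assumes "\<theta> \<in> {0..1}"
  shows "xh (lo k) + \<theta> *\<^sub>R edge_vec xh k \<in> tri xh"
  using edge_subset_tri[of xh k] assms unfolding edge_eq_image by blast

lemma F_edge_param:
  assumes "\<theta> \<in> {0..1}"
  shows "F (xh (lo k) + \<theta> *\<^sub>R edge_vec xh k) = x (lo k) + \<theta> *\<^sub>R edge_vec x k"
proof -
  have "x (lo k) = J *v xh (lo k) + shift"
    using affine_form[OF vertex_in_tri] by (simp add: vertices)
  moreover have "F (xh (lo k) + \<theta> *\<^sub>R edge_vec xh k) = J *v (xh (lo k) + \<theta> *\<^sub>R edge_vec xh k) + shift"
    by (rule affine_form[OF edge_param_in_tri[OF assms]])
  ultimately show ?thesis
    by (simp add: edge_vec_image matrix_vector_right_distrib matrix_vector_mult_scaleR)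
qed

lemma edge_image: "edge x k = F ` edge xh k"
  unfolding edge_eq_image image_image using F_edge_param by (intro image_cong) auto

lemma piola_at:
  assumes "y \<in> tri xh"
  shows "T \<tau> (F y) = (1 / (det J)\<^sup>2) *\<^sub>R (J ** \<tau> y ** transpose J)"
  by (simp add: piola_def inv_into_f_f[OF inj assms])

lemma tangent_image: "tangent x k = ratio k *\<^sub>R (J *v tangent xh k)"
  using edge_vec_nonzero[OF nondegenerate_source, of k]
  by (simp add: tangent_def ratio_def edge_vec_image[of k] matrix_vector_mult_scaleR)

lemma normal_pullback: "transpose J *v normal x k = (ratio k * det J) *\<^sub>R normal xh k"
  by (simp add: normal_def tangent_image matrix_vector_mult_scaleR rot_cofactor)

text \<open>
  The outer factor \<open>J\<close> of the Piola map moves to \<open>n\<close> as a transpose and one power of \<open>det J\<close> cancels,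
  for any second vector \<open>s\<close>.
\<close>
lemma piola_pairing:
  assumes "y \<in> tri xh"
  shows "normal x k \<bullet> (T \<tau> (F y) *v s)
    = (ratio k / det J) * (normal xh k \<bullet> (\<tau> y *v (transpose J *v s)))"
proof -
  have "normal x k \<bullet> (T \<tau> (F y) *v s)
      = (1 / (det J)\<^sup>2) * (normal x k \<bullet> (J *v (\<tau> y *v (transpose J *v s))))"
    by (simp add: piola_at[OF assms] scaleR_matrix_vector matrix_vector_mul_assoc matrix_mul_assoc)
  also have "normal x k \<bullet> (J *v (\<tau> y *v (transpose J *v s)))
      = (transpose J *v normal x k) \<bullet> (\<tau> y *v (transpose J *v s))"
    by (metis dot_lmul_matrix vector_transpose_matrix transpose_transpose)
  also have "(1 / (det J)\<^sup>2) * \<dots> = (ratio k / det J) * (normal xh k \<bullet> (\<tau> y *v (transpose J *v s)))"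
    using det_nonzero by (simp add: normal_pullback power2_eq_square)
  finally show ?thesis .
qed

lemma normal_normal:
  assumes "y \<in> tri xh"
  shows "normal x k \<bullet> (T \<tau> (F y) *v normal x k) = (ratio k)\<^sup>2 * (normal xh k \<bullet> (\<tau> y *v normal xh k))"
  using det_nonzero
  by (simp add: piola_pairing[OF assms] normal_pullback matrix_vector_mult_scaleR power2_eq_square)

text \<open>
  This is where \<open>\<alpha>\<close> and \<open>\<beta>\<close> come from: up to \<open>det J\<close> they are the coordinates of the pulled back
  tangent in the orthonormal frame of the reference edge.
\<close>
lemma edge_coeffs_expansion:
  "transpose J *v (J *v tangent xh k) =
     det J *\<^sub>R (edge_coeffs xh J k $ 1 *\<^sub>R normal xh k + edge_coeffs xh J k $ 2 *\<^sub>R tangent xh k)"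
proof -
  let ?v = "transpose J *v (J *v tangent xh k)"
  have "norm (tangent xh k) = 1"
    using edge_vec_nonzero[OF nondegenerate_source, of k] by (simp add: tangent_def)
  moreover have "edge_coeffs xh J k = (1 / det J) *\<^sub>R (vector [normal xh k, tangent xh k] *v ?v)"
    by (simp add: edge_coeffs_def matrix_vector_mul_assoc matrix_mul_assoc)
  then have "det J * edge_coeffs xh J k $ 1 = normal xh k \<bullet> ?v"
    and "det J * edge_coeffs xh J k $ 2 = tangent xh k \<bullet> ?v"
    using det_nonzero by (simp_all add: matrix_vector_mult_def[of "vector _"] inner_vec_def)
  ultimately show ?thesis
    using rot_orthonormal_expansion[of "tangent xh k" ?v]
    by (simp add: normal_def[symmetric] scaleR_add_right)
qed

lemma normal_tangent:
  assumes "y \<in> tri xh"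
  shows "normal x k \<bullet> (T \<tau> (F y) *v tangent x k) = (ratio k)\<^sup>2 *
    (edge_coeffs xh J k $ 1 * (normal xh k \<bullet> (\<tau> y *v normal xh k))
     + edge_coeffs xh J k $ 2 * (normal xh k \<bullet> (\<tau> y *v tangent xh k)))"
  using det_nonzero
  by (simp add: piola_pairing[OF assms] tangent_image edge_coeffs_expansion
      matrix_vector_mult_scaleR matrix_vector_right_distrib inner_add_right power2_eq_square
      algebra_simps)

lemma dof_edge_piola:
  "dof_edge x w s k (T \<tau>) = integral {0..1} (\<lambda>\<theta>.
     (normal x k \<bullet> (T \<tau> (F (xh (lo k) + \<theta> *\<^sub>R edge_vec xh k)) *v s)) * w \<theta> * norm (edge_vec x k))"
  unfolding dof_edge_def by (intro integral_cong) (simp add: F_edge_param)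

text \<open>
  The arc length element turns one of the two factors \<open>r\<close> into the change of edge length.
\<close>
lemma ratio_norm: "(ratio k)\<^sup>2 * (a * norm (edge_vec x k)) = ratio k * (a * norm (edge_vec xh k))"
  using edge_vec_nonzero[OF nondegenerate_target, of k] by (simp add: ratio_def power2_eq_square)

lemma dof_edge_normal:
  "dof_edge x w (normal x k) k (T \<tau>) = ratio k * dof_edge xh w (normal xh k) k \<tau>"
proof -
  have "dof_edge x w (normal x k) k (T \<tau>) = integral {0..1} (\<lambda>\<theta>. ratio k *
      ((normal xh k \<bullet> (\<tau> (xh (lo k) + \<theta> *\<^sub>R edge_vec xh k) *v normal xh k)) * w \<theta> * norm (edge_vec xh k)))"
    unfolding dof_edge_piola
  proof (intro integral_cong)
    fix \<theta> :: real assume "\<theta> \<in> {0..1}"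
    note y = edge_param_in_tri[OF this, of k]
    let ?y = "xh (lo k) + \<theta> *\<^sub>R edge_vec xh k"
    have "(normal x k \<bullet> (T \<tau> (F ?y) *v normal x k)) * w \<theta> * norm (edge_vec x k)
      = (ratio k)\<^sup>2 * ((normal xh k \<bullet> (\<tau> ?y *v normal xh k)) * w \<theta> * norm (edge_vec x k))"
      by (simp add: normal_normal[OF y] mult.assoc)
    also have "\<dots> = ratio k * ((normal xh k \<bullet> (\<tau> ?y *v normal xh k)) * w \<theta> * norm (edge_vec xh k))"
      by (rule ratio_norm)
    finally show "(normal x k \<bullet> (T \<tau> (F ?y) *v normal x k)) * w \<theta> * norm (edge_vec x k)
      = ratio k * ((normal xh k \<bullet> (\<tau> ?y *v normal xh k)) * w \<theta> * norm (edge_vec xh k))" .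
  qed
  then show ?thesis
    by (simp add: dof_edge_def)
qed

lemma dof_edge_tangent:
  assumes "continuous_on (tri xh) \<tau>" and "continuous_on {0..1} w"
  shows "dof_edge x w (tangent x k) k (T \<tau>) =
    ratio k * (edge_coeffs xh J k $ 1 * dof_edge xh w (normal xh k) k \<tau>
             + edge_coeffs xh J k $ 2 * dof_edge xh w (tangent xh k) k \<tau>)"
proof -
  let ?f = "\<lambda>s \<theta>. (normal xh k \<bullet> (\<tau> (xh (lo k) + \<theta> *\<^sub>R edge_vec xh k) *v s)) * w \<theta> * norm (edge_vec xh k)"
  have int: "?f s integrable_on {0..1}" for s
    using assms by (intro integrable_continuous_interval edge_integrand_continuous)
  have "dof_edge x w (tangent x k) k (T \<tau>) = integral {0..1} (\<lambda>\<theta>. ratio k *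
      (edge_coeffs xh J k $ 1 * ?f (normal xh k) \<theta> + edge_coeffs xh J k $ 2 * ?f (tangent xh k) \<theta>))"
    unfolding dof_edge_piola
  proof (intro integral_cong)
    fix \<theta> :: real assume "\<theta> \<in> {0..1}"
    note y = edge_param_in_tri[OF this, of k]
    let ?y = "xh (lo k) + \<theta> *\<^sub>R edge_vec xh k"
    let ?g = "\<lambda>s. normal xh k \<bullet> (\<tau> ?y *v s)"
    have "(normal x k \<bullet> (T \<tau> (F ?y) *v tangent x k)) * w \<theta> * norm (edge_vec x k)
      = (ratio k)\<^sup>2 * ((edge_coeffs xh J k $ 1 * ?g (normal xh k) + edge_coeffs xh J k $ 2 * ?g (tangent xh k))
          * w \<theta> * norm (edge_vec x k))"
      by (simp add: normal_tangent[OF y] mult.assoc)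
    also have "\<dots> = ratio k * ((edge_coeffs xh J k $ 1 * ?g (normal xh k) + edge_coeffs xh J k $ 2 * ?g (tangent xh k))
          * w \<theta> * norm (edge_vec xh k))"
      by (rule ratio_norm)
    finally show "(normal x k \<bullet> (T \<tau> (F ?y) *v tangent x k)) * w \<theta> * norm (edge_vec x k) =
      ratio k * (edge_coeffs xh J k $ 1 * ?f (normal xh k) \<theta> + edge_coeffs xh J k $ 2 * ?f (tangent xh k) \<theta>)"
      by (simp add: distrib_right mult.assoc)
  qed
  also have "\<dots> = ratio k * (edge_coeffs xh J k $ 1 * integral {0..1} (?f (normal xh k))
      + edge_coeffs xh J k $ 2 * integral {0..1} (?f (tangent xh k)))"
    using int by (simp add: integral_add integrable_on_mult_right)
  finally show ?thesis
    by (simp add: dof_edge_def)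
qed

text \<open>
  The symmetry of the situation yields surjectivity of the Piola map and continuity of the inverse of
  \<open>F\<close> without separate proofs.
\<close>
lemma inverse_map: "triangle_map x xh (inv_into (tri xh) F) (matrix_inv J)"
proof
  have "inv_into (tri xh) F y = matrix_inv J *v y + - (matrix_inv J *v shift)" if "y \<in> tri x" for y
  proof -
    have "y \<in> F ` tri xh"
      using that by (simp add: image)
    then obtain z where z: "z \<in> tri xh" "y = F z" ..
    then have "matrix_inv J *v y = z + matrix_inv J *v shift"
      by (simp add: affine_form matrix_vector_right_distrib matrix_vector_mul_assoc
          matrix_inv_mult[OF invertible_J])
    with z show ?thesis
      by (simp add: inv_into_f_f[OF inj])
  qed
  moreover have "invertible (matrix_inv J)"
    using matrix_inv_mult[OF invertible_J] by (auto simp: invertible_def)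
  ultimately show "affine_diffeo (inv_into (tri xh) F) (matrix_inv J) (tri x) (tri xh)"
    using bij_betw_inv_into[OF bij] unfolding affine_diffeo_def by blast
  show "inv_into (tri xh) F (x i) = xh i" for i
    using inv_into_f_f[OF inj vertex_in_tri] by (simp add: vertices)
qed (rule nondegenerate_target nondegenerate_source)+

text \<open>
  The normal-normal component on an edge is, up to a constant factor, that of \<open>\<tau>\<close> on the reference
  edge; hence the constraint that it be affine there is preserved.
\<close>
lemma piola_AWnc:
  assumes "\<tau> \<in> AWnc xh"
  shows "T \<tau> \<in> AWnc x"
proof -
  let ?G = "inv_into (tri xh) F"
  interpret inverse: triangle_map x xh ?G "matrix_inv J" by (rule inverse_map)
  note G = inverse.affine_form
  have G_tri: "?G y \<in> tri xh" and FG: "F (?G y) = y" if "y \<in> tri x" for y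
    using that by (auto simp flip: image intro: inv_into_into f_inv_into_f)
  have G_edge: "?G y \<in> edge xh k" if "y \<in> edge x k" for y k
    using that by (simp add: inverse.edge_image)
  have poly: "(\<lambda>y. \<tau> y $ i $ j) \<in> poly_on 2 (tri xh)" for i j
    using assms by (simp add: AWnc_def sym_poly_on_def)
  have "(\<lambda>y. T \<tau> y $ i $ j) \<in> poly_on 2 (tri x)" for i j
  proof -
    have "(\<lambda>y. \<Sum>k\<in>UNIV. \<Sum>l\<in>UNIV. (1 / (det J)\<^sup>2 * J $ i $ k * J $ j $ l) * \<tau> (?G y) $ k $ l) \<in> poly_on 2 (tri x)"
      using G G_tri
      by (intro poly_on_sum poly_on_scale poly_on_affine_compose[OF poly, of "tri x" ?G]) auto
    then show ?thesis
      by (rule poly_on_cong)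
        (simp add: piola_def matrix_matrix_mult_def transpose_def sum_2 algebra_simps)
  qed
  moreover have "transpose (T \<tau> y) = T \<tau> y" if "y \<in> tri x" for y
    using assms G_tri[OF that]
    by (simp add: piola_def matrix_transpose_mul AWnc_def sym_poly_on_def matrix_mul_assoc
        transpose_scalar)
  moreover have "(\<lambda>y. normal x k \<bullet> (T \<tau> y *v normal x k)) \<in> poly_on 1 (edge x k)" for k
  proof -
    have "(\<lambda>y. normal xh k \<bullet> (\<tau> y *v normal xh k)) \<in> poly_on 1 (edge xh k)"
      using assms by (simp add: AWnc_def)
    then have "(\<lambda>y. (ratio k)\<^sup>2 * (normal xh k \<bullet> (\<tau> (?G y) *v normal xh k))) \<in> poly_on 1 (edge x k)"
      using G G_edge edge_subset_tri[of x k]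
      by (intro poly_on_scale poly_on_affine_compose[where S = "edge xh k" and g = ?G]) auto
    then show ?thesis
    proof (rule poly_on_cong)
      fix y assume "y \<in> edge x k"
      then have y: "y \<in> tri x" using edge_subset_tri by blast
      show "normal x k \<bullet> (T \<tau> y *v normal x k) = (ratio k)\<^sup>2 * (normal xh k \<bullet> (\<tau> (?G y) *v normal xh k))"
        using normal_normal[OF G_tri[OF y], of k \<tau>] by (simp add: FG[OF y])
    qed
  qed
  ultimately show ?thesis
    by (simp add: AWnc_def sym_poly_on_def)
qed

text \<open>
  The preimage is the Piola transform under the inverse map: the determinants cancel, and
  \<open>J\<close> and its inverse multiply to 1 on both sides.
\<close>
lemma piola_surj:
  assumes "\<tau> \<in> AWnc x"
  obtains \<sigma> where "\<sigma> \<in> AWnc xh" and "\<And>y. y \<in> tri x \<Longrightarrow> T \<sigma> y = \<tau> y"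
proof -
  let ?G = "inv_into (tri xh) F"
  interpret inverse: triangle_map x xh ?G "matrix_inv J" by (rule inverse_map)
  have "T (inverse.T \<tau>) y = \<tau> y" if y: "y \<in> tri x" for y
  proof -
    have "det J * det (matrix_inv J) = det (mat 1 :: real^2^2)"
      unfolding det_mul[symmetric] matrix_inv_mult(2)[OF invertible_J] ..
    then have det: "(1 / (det J)\<^sup>2) * (1 / (det (matrix_inv J))\<^sup>2) = 1"
      by (simp add: power_mult_distrib[symmetric])
    have "transpose (matrix_inv J) ** transpose J = mat 1"
      unfolding matrix_transpose_mul[symmetric] matrix_inv_mult(2)[OF invertible_J]
      by simp
    then have "J ** (matrix_inv J ** \<tau> y ** transpose (matrix_inv J)) ** transpose J = \<tau> y"
      by (metis matrix_inv_mult(2)[OF invertible_J] matrix_mul_assoc matrix_mul_lid matrix_mul_rid)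
    moreover have "T (inverse.T \<tau>) y = ((1 / (det J)\<^sup>2) * (1 / (det (matrix_inv J))\<^sup>2)) *\<^sub>R
        (J ** (matrix_inv J ** \<tau> y ** transpose (matrix_inv J)) ** transpose J)"
      using inverse.piola_at[OF y, of \<tau>]
      by (simp add: piola_def[of F] linear_cmul[OF linear_congruence, where B1 = J])
    ultimately show ?thesis
      by (simp only: det scaleR_one)
  qed
  with inverse.piola_AWnc[OF assms] show thesis
    by (rule that)
qed

text \<open>
  The sign of \<open>det J\<close> is lost here: \<open>\<bar>det J\<bar> / (det J)\<^sup>2 = 1 / \<bar>det J\<bar>\<close>.
\<close>
lemma dof_int_piola:
  assumes "continuous_on (tri xh) \<tau>"
  shows "dof_int x i j (T \<tau>)
    = (1 / \<bar>det J\<bar>) * (\<Sum>k\<in>UNIV. \<Sum>l\<in>UNIV. J $ i $ k * J $ j $ l * dof_int xh k l \<tau>)"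
proof -
  let ?c = "1 / (det J)\<^sup>2"
  interpret inverse: triangle_map x xh "inv_into (tri xh) F" "matrix_inv J" by (rule inverse_map)
  have entry: "T \<tau> (F y) $ i $ j = ?c * (\<Sum>k\<in>UNIV. \<Sum>l\<in>UNIV. J $ i $ k * J $ j $ l * \<tau> y $ k $ l)"
    if "y \<in> tri xh" for y
    by (simp add: piola_at[OF that] matrix_matrix_mult_def transpose_def sum_2 algebra_simps)
  have "continuous_on (tri x) (\<lambda>y. matrix_inv J *v y + inverse.shift)"
    by (intro continuous_intros linear_continuous_on_compose[OF continuous_on_id] matrix_vector_mul_linear)
  then have "continuous_on (tri x) (inv_into (tri xh) F)"
    by (rule continuous_on_eq) (simp add: inverse.affine_form)
  then have "continuous_on (tri x) (\<lambda>y. \<tau> (inv_into (tri xh) F y))"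
    by (intro continuous_on_compose2[OF assms]) (auto simp: image intro: inv_into_into)
  then have "continuous_on (tri x) (T \<tau>)"
    unfolding piola_def
    by (intro continuous_on_scaleR continuous_on_const linear_continuous_on_compose[OF _ linear_congruence])
  then have "continuous_on (F ` tri xh) (\<lambda>y. T \<tau> y $ i $ j)"
    unfolding image by (rule linear_continuous_on_compose[OF _ linear_entry])
  then have "dof_int x i j (T \<tau>) = \<bar>det J\<bar> * integral (tri xh) (\<lambda>y. T \<tau> (F y) $ i $ j)"
    unfolding dof_int_def image[symmetric]
    using integral_affine_image[OF tri_compact affine_form inj] by simp
  also have "integral (tri xh) (\<lambda>y. T \<tau> (F y) $ i $ j)
      = integral (tri xh) (\<lambda>y. ?c * (\<Sum>k\<in>UNIV. \<Sum>l\<in>UNIV. J $ i $ k * J $ j $ l * \<tau> y $ k $ l))"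
    by (intro integral_cong entry)
  also have "\<dots> = ?c * (\<Sum>k\<in>UNIV. \<Sum>l\<in>UNIV. J $ i $ k * J $ j $ l * dof_int xh k l \<tau>)"
  proof -
    have "(\<lambda>y. \<tau> y $ k $ l) integrable_on tri xh" for k l
      by (rule entry_integrable[OF assms])
    then show ?thesis
      by (simp add: dof_int_def integral_sum integrable_sum integrable_on_mult_right)
  qed
  finally have "dof_int x i j (T \<tau>)
      = (\<bar>det J\<bar> * ?c) * (\<Sum>k\<in>UNIV. \<Sum>l\<in>UNIV. J $ i $ k * J $ j $ l * dof_int xh k l \<tau>)"
    by (simp only: mult.assoc)
  moreover have "\<bar>det J\<bar> * ?c = 1 / \<bar>det J\<bar>"
    using det_nonzero by (simp add: power2_eq_square abs_if)
  ultimately show ?thesis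
    by (simp only:)
qed

abbreviation W :: "real^idx^idx" where
  "W \<equiv> block_diag (W_edge xh x J) (sgn (det J) *\<^sub>R W_check J)"

lemma dofs_piola:
  assumes "edge_weights \<mu>" and \<tau>: "\<tau> \<in> AWnc xh"
  shows "dofs x \<mu> r (T \<tau>) = (W *v (\<chi> r. dofs xh \<mu> r \<tau>)) $ r"
proof (cases r)
  case (Inl p)
  obtain k a where p: "p = (k, a)" by force
  note tangent = dof_edge_tangent[OF AWnc_continuous[OF \<tau>] edge_weights_continuous[OF assms(1)]]
  have edge: "W_edge xh x J k = ratio k *\<^sub>R
      (let \<alpha> = edge_coeffs xh J k $ 1; \<beta> = edge_coeffs xh J k $ 2
       in vector [vector [1, 0, 0, 0], vector [\<alpha>, \<beta>, 0, 0],
                  vector [0, 0, 1, 0], vector [0, 0, \<alpha>, \<beta>]])"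
    by (simp add: W_edge_def ratio_def Let_def)
  consider "a = 1" | "a = 2" | "a = 3" | "a = 4" using exhaust_4 by blast
  then show ?thesis
    unfolding Inl p
    by cases (simp_all add: block_diag_mult_vec sum_4 edge Let_def vector_4 dofs_cases
        dof_edge_normal tangent algebra_simps)
next
  case (Inr m)
  have "\<tau> y $ 2 $ 1 = \<tau> y $ 1 $ 2" if "y \<in> tri xh" for y
  proof -
    have "transpose (\<tau> y) $ 1 $ 2 = \<tau> y $ 1 $ 2"
      using \<tau> that by (simp add: AWnc_def sym_poly_on_def)
    then show ?thesis by (simp add: transpose_def)
  qed
  then have sym: "dof_int xh 2 1 \<tau> = dof_int xh 1 2 \<tau>"
    unfolding dof_int_def by (rule integral_cong)
  define c where "c = 1 / \<bar>det J\<bar>"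
  have check: "sgn (det J) *\<^sub>R W_check J = c *\<^sub>R
      vector [vector [(J$1$1)\<^sup>2, 2 * J$1$1 * J$1$2, (J$1$2)\<^sup>2],
              vector [J$1$1 * J$2$1, J$1$1 * J$2$2 + J$1$2 * J$2$1, J$1$2 * J$2$2],
              vector [(J$2$1)\<^sup>2, 2 * J$2$1 * J$2$2, (J$2$2)\<^sup>2]]"
    unfolding W_check_def c_def scaleR_scaleR by (simp add: sgn_if)
  have int: "dof_int x i j (T \<tau>)
      = c * (\<Sum>k\<in>UNIV. \<Sum>l\<in>UNIV. J $ i $ k * J $ j $ l * dof_int xh k l \<tau>)" for i j
    unfolding c_def by (rule dof_int_piola[OF AWnc_continuous[OF \<tau>]])
  consider "m = 1" | "m = 2" | "m = 3" using exhaust_3 by blast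
  then show ?thesis
    unfolding Inr
    by cases (simp_all add: block_diag_mult_vec check sum_3 sum_2 dofs_cases sym int
        power2_eq_square algebra_simps)
qed

text \<open>
  In fact \<open>det J * \<beta> = \<bar>J th\<bar>\<^sup>2\<close>, where \<open>th\<close> is the reference tangent.
\<close>
lemma tangent_coeff: "det J * edge_coeffs xh J k $ 2 \<noteq> 0"
proof -
  have "(transpose J *v (J *v tangent xh k)) \<bullet> tangent xh k = (J *v tangent xh k) \<bullet> (J *v tangent xh k)"
    by (metis dot_lmul_matrix vector_transpose_matrix transpose_transpose inner_commute)
  moreover have "tangent x k \<noteq> 0"
    using edge_vec_nonzero[OF nondegenerate_target] by (simp add: tangent_def)
  then have "J *v tangent xh k \<noteq> 0"
    by (auto simp: tangent_image)
  ultimately have "(transpose J *v (J *v tangent xh k)) \<bullet> tangent xh k \<noteq> 0"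
    by simp
  moreover have "normal xh k \<bullet> tangent xh k = 0"
    by (simp add: normal_def rot_def inner_vec_def matrix_vector_mult_def sum_2)
  ultimately show ?thesis
    by (auto simp: edge_coeffs_expansion inner_add_left)
qed

lemma W_edge_invertible: "invertible (W_edge xh x J k)"
proof -
  have "v = 0" if v: "W_edge xh x J k *v v = 0" for v
  proof -
    let ?\<alpha> = "edge_coeffs xh J k $ 1" and ?\<beta> = "edge_coeffs xh J k $ 2"
    have "ratio k *\<^sub>R vector [v $ 1, ?\<alpha> * v $ 1 + ?\<beta> * v $ 2, v $ 3, ?\<alpha> * v $ 3 + ?\<beta> * v $ 4]
        = W_edge xh x J k *v v"
      by (simp add: W_edge_def Let_def vector_4 matrix_vector_mult_def sum_4 ratio_def vec_eq_iff
          forall_4 add_divide_distrib algebra_simps)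
    then have "vector [v $ 1, ?\<alpha> * v $ 1 + ?\<beta> * v $ 2, v $ 3, ?\<alpha> * v $ 3 + ?\<beta> * v $ 4] = (0 :: real^4)"
      using ratio_nonzero[of k] v by simp
    then show "v = 0"
      using tangent_coeff[of k] by (auto simp: vec_eq_iff forall_4 vector_4)
  qed
  then show ?thesis
    unfolding invertible_left_inverse matrix_left_invertible_ker by blast
qed

lemma W_check_invertible: "invertible (sgn (det J) *\<^sub>R W_check J)"
proof -
  have "W_check J ** W_check (matrix_inv J) = mat 1"
    by (simp flip: W_check_mult add: matrix_inv_mult[OF invertible_J] W_check_1)
  then have "invertible (W_check J)"
    by (rule matrix_inv_eqI)
  then show ?thesis
    using det_nonzero by (intro scalar_invertible) (simp_all add: sgn_if)
qed

text \<open>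
  \<open>dofs i (T (\<Psi> l)) = W i l\<close> by duality of \<open>\<Psi>\<close>, so the pairing of the degrees of freedom with the new
  family is \<open>W P = 1\<close>. For spanning, an expansion with coefficients \<open>c = P (W c)\<close> in the \<open>T (\<Psi> i)\<close> has
  coefficients \<open>W c\<close> in the new family.
\<close>
lemma nodal_basis_piola:
  assumes weights: "edge_weights \<mu>" and \<Psi>: "nodal_basis xh \<mu> \<Psi>"
    and P: "P ** W = mat 1"
  shows "nodal_basis x \<mu> (\<lambda>j y. \<Sum>i\<in>UNIV. transpose P $ j $ i *\<^sub>R T (\<Psi> i) y)"
proof (rule nodal_basisI[OF weights])
  let ?\<Phi> = "\<lambda>j y. \<Sum>i\<in>UNIV. transpose P $ j $ i *\<^sub>R T (\<Psi> i) y"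
  have \<Psi>_AW: "\<Psi> i \<in> AWnc xh" and dual: "dofs xh \<mu> l (\<Psi> i) = (if l = i then 1 else 0)" for i l
    using \<Psi> by (auto simp: nodal_basis_def basis_on_def)
  show "?\<Phi> j \<in> AWnc x" for j
    by (intro AWnc_sum piola_AWnc \<Psi>_AW)
  have dofs_T: "dofs x \<mu> i (T (\<Psi> l)) = W $ i $ l" for i l
  proof -
    have "dofs x \<mu> i (T (\<Psi> l)) = (\<Sum>m\<in>UNIV. if m = l then W $ i $ m else 0)"
      unfolding dofs_piola[OF weights \<Psi>_AW] matrix_vector_mult_def vec_lambda_beta dual
      by (intro sum.cong) auto
    then show ?thesis by simp
  qed
  have "W ** P = mat 1"
    using P matrix_left_right_inverse by blast
  show "dofs x \<mu> i (?\<Phi> j) = (if i = j then 1 else 0)" for i j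
  proof -
    have "dofs x \<mu> i (?\<Phi> j) = (\<Sum>l\<in>UNIV. transpose P $ j $ l * W $ i $ l)"
      by (simp add: dofs_sum[OF weights finite piola_AWnc[OF \<Psi>_AW]] dofs_T)
    also have "\<dots> = (W ** P) $ i $ j"
      by (simp add: matrix_matrix_mult_def transpose_def mult.commute)
    finally show ?thesis
      by (simp add: \<open>W ** P = mat 1\<close> mat_def)
  qed
  fix \<tau> assume "\<tau> \<in> AWnc x"
  then obtain \<sigma> where \<sigma>: "\<sigma> \<in> AWnc xh" and T\<sigma>: "\<And>y. y \<in> tri x \<Longrightarrow> T \<sigma> y = \<tau> y"
    by (rule piola_surj) blast
  define c where "c = (\<chi> i. dofs xh \<mu> i \<sigma>)"
  have "\<tau> y = (\<Sum>j\<in>UNIV. (W *v c) $ j *\<^sub>R ?\<Phi> j y)" if y: "y \<in> tri x" for y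
  proof -
    have "y \<in> F ` tri xh"
      using y by (simp add: image)
    then obtain z where z: "z \<in> tri xh" "y = F z" ..
    let ?T = "\<lambda>A. (1 / (det J)\<^sup>2) *\<^sub>R (J ** A ** transpose J)"
    have lin: "linear ?T"
      by (intro linear_compose_scale_right linear_congruence)
    have "\<tau> y = ?T (\<sigma> z)"
      using T\<sigma>[OF y] z by (simp add: piola_at)
    also have "\<sigma> z = (\<Sum>i\<in>UNIV. c $ i *\<^sub>R \<Psi> i z)"
      using nodal_basis_expansion[OF weights \<Psi> \<sigma> z(1)] by (simp add: c_def)
    also have "?T \<dots> = (\<Sum>i\<in>UNIV. c $ i *\<^sub>R ?T (\<Psi> i z))"
      unfolding linear_sum[OF lin] linear_cmul[OF lin] ..
    also have "\<dots> = (\<Sum>i\<in>UNIV. (P *v (W *v c)) $ i *\<^sub>R T (\<Psi> i) y)"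
      by (simp add: matrix_vector_mul_assoc P piola_at[OF z(1)] z(2))
    also have "\<dots> = (\<Sum>i\<in>UNIV. \<Sum>j\<in>UNIV. ((W *v c) $ j * P $ i $ j) *\<^sub>R T (\<Psi> i) y)"
      by (simp add: matrix_vector_mult_def[of P] scaleR_sum_left mult.commute)
    also have "\<dots> = (\<Sum>j\<in>UNIV. (W *v c) $ j *\<^sub>R ?\<Phi> j y)"
      unfolding scaleR_sum_right by (subst sum.swap) (simp add: transpose_def)
    finally show ?thesis .
  qed
  then have expansion: "\<forall>y\<in>tri x. \<tau> y = (\<Sum>j\<in>UNIV. (W *v c) $ j *\<^sub>R ?\<Phi> j y)"
    by (rule ballI)
  have "\<exists>d. \<forall>y\<in>tri x. \<tau> y = (\<Sum>j\<in>UNIV. d j *\<^sub>R ?\<Phi> j y)"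
    by (rule exI[where x = "\<lambda>j. (W *v c) $ j"]) (rule expansion)
  then show "\<exists>d. \<forall>y\<in>tri x. \<tau> y = (\<Sum>j\<in>UNIV. d j *\<^sub>R ?\<Phi> j y)" .
qed

end

section \<open>The transformation theorem\<close>

theorem mainTheorem2:
  fixes xh x :: "3 \<Rightarrow> real^2"
    and F :: "real^2 \<Rightarrow> real^2"
    and J :: "real^2^2"
    and \<mu> :: "2 \<Rightarrow> real \<Rightarrow> real"
  assumes "nondegenerate xh" and "nondegenerate x"
    and "affine_diffeo F J (tri xh) (tri x)"
    and "\<And>i. F (xh i) = x i"
    and "edge_weights \<mu>"
  shows "let T = piola F J (tri xh);
             W = block_diag (W_edge xh x J) (sgn (det J) *\<^sub>R W_check J);
             P = block_diag (\<lambda>k. matrix_inv (W_edge xh x J k))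
                            (matrix_inv (sgn (det J) *\<^sub>R W_check J))
         in (\<forall>\<tau>\<in>AWnc xh.
               (\<chi> r. pushforward T (dofs x \<mu> r) \<tau>) = W *v (\<chi> r. dofs xh \<mu> r \<tau>))
          \<and> (invertible W \<and> P = matrix_inv W)
          \<and> (\<forall>\<tau>\<in>AWnc xh.
               (\<chi> r. dofs xh \<mu> r \<tau>) = P *v (\<chi> r. pushforward T (dofs x \<mu> r) \<tau>))
          \<and> (\<forall>\<Psi>h. nodal_basis xh \<mu> \<Psi>h \<longrightarrow>
               nodal_basis x \<mu> (\<lambda>j y. \<Sum>i\<in>UNIV. transpose P $ j $ i *\<^sub>R T (\<Psi>h i) y)
             \<and> (\<forall>\<Psi>. nodal_basis x \<mu> \<Psi> \<longrightarrow>
                  (\<forall>j. \<forall>y\<in>tri x.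
                     \<Psi> j y = (\<Sum>i\<in>UNIV. transpose P $ j $ i *\<^sub>R T (\<Psi>h i) y))))"
proof -
  interpret triangle_map xh x F J
    using assms by unfold_locales
  define P where "P = block_diag (\<lambda>k. matrix_inv (W_edge xh x J k))
                        (matrix_inv (sgn (det J) *\<^sub>R W_check J))"
  have inv: "invertible W" "P = matrix_inv W"
    unfolding P_def
    using block_diag_inverse[of "W_edge xh x J", OF W_edge_invertible W_check_invertible] by simp_all
  have PW: "P ** W = mat 1"
    by (simp add: inv matrix_inv_mult)
  have push: "\<forall>\<tau>\<in>AWnc xh. (\<chi> r. pushforward T (dofs x \<mu> r) \<tau>) = W *v (\<chi> r. dofs xh \<mu> r \<tau>)"
    using dofs_piola[OF assms(5)] by (simp add: vec_eq_iff pushforward_def)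
  then have pull: "\<forall>\<tau>\<in>AWnc xh. (\<chi> r. dofs xh \<mu> r \<tau>) = P *v (\<chi> r. pushforward T (dofs x \<mu> r) \<tau>)"
    by (simp add: matrix_vector_mul_assoc PW)
  have basis: "\<forall>\<Psi>h. nodal_basis xh \<mu> \<Psi>h \<longrightarrow>
      nodal_basis x \<mu> (\<lambda>j y. \<Sum>i\<in>UNIV. transpose P $ j $ i *\<^sub>R T (\<Psi>h i) y)
    \<and> (\<forall>\<Psi>. nodal_basis x \<mu> \<Psi> \<longrightarrow>
         (\<forall>j. \<forall>y\<in>tri x. \<Psi> j y = (\<Sum>i\<in>UNIV. transpose P $ j $ i *\<^sub>R T (\<Psi>h i) y)))"
  proof (intro allI impI)
    fix \<Psi>h assume "nodal_basis xh \<mu> \<Psi>h"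
    note basis = nodal_basis_piola[OF assms(5) this PW]
    show "nodal_basis x \<mu> (\<lambda>j y. \<Sum>i\<in>UNIV. transpose P $ j $ i *\<^sub>R T (\<Psi>h i) y)
      \<and> (\<forall>\<Psi>. nodal_basis x \<mu> \<Psi> \<longrightarrow>
           (\<forall>j. \<forall>y\<in>tri x. \<Psi> j y = (\<Sum>i\<in>UNIV. transpose P $ j $ i *\<^sub>R T (\<Psi>h i) y)))"
    proof (intro conjI allI impI ballI)
      fix \<Psi> j y assume "nodal_basis x \<mu> \<Psi>" and "y \<in> tri x"
      then show "\<Psi> j y = (\<Sum>i\<in>UNIV. transpose P $ j $ i *\<^sub>R T (\<Psi>h i) y)"
        by (rule nodal_basis_unique[OF assms(5) basis])
    qed (rule basis)
  qed
  show ?thesis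
    unfolding Let_def P_def[symmetric]
    by (intro conjI) (rule push inv pull basis)+
qed

end
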